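(* Let $\Sigma=\{a\}$ with $\sharp a=2$, and for each integer $k\ge 1$ let $G_{a^k}$ be the circular string with $k$ vertices over $\{a\}$. The finite support series $r$ on the family of circular strings over $\{a\}$ defined by $r(G_a)=1$ and $r(G_{a^k})=0$ for every integer $k>1$ is not recognizable.
   Context: Throughout, $\mathbb K=\mathbb R$ or $\mathbb C$, $[d]=\{1,\dots,d\}$, and $(\mathbf e_1,\dots,\mathbf e_d)$ is the canonical basis of $\mathbb K^d$. A ranked alphabet $(\Sigma,\sharp)$ is a finite set $\Sigma$ with an arity map $\sharp:\Sigma\to\mathbb N$; it is positive if $\sharp x\ge 1$ for all $x\in\Sigma$. A hypergraph $G=(V,E,l)$ over a positive ranked alphabet $(\Sigma,\sharp)$ consists of a non-empty finite set $V$ (vertices), a map $l:V\to\Sigma$, and a partition $E$ (whose non-empty blocks are called hyperedges) of the set of ports $P_G=\{(v,j): v\in V, 1\le j\le \sharp v\}$, where $\sharp v=\sharp l(v)$. $G$ is connected if for every partition $V=V_1\cup V_2$ into two non-empty sets there are a hyperedge $h$ and ports $(v_1,i),(v_2,j)\in h$ with $v_1\in V_1$, $v_2\in V_2$. A circular string over $\Sigma$ (all symbols having arity 2) is a connected hypergraph all of whose hyperedges are of the form $\{(v,2),(w,1)\}$ with $v,w\in V$ (possibly $v=w$). Over $\Sigma=\{a\}$, $G_{a^k}$ is the circular string with vertices $1,\dots,k$, all labelled $a$, and hyperedges $\{(i,2),(i+1,1)\}$ for $1\le i<k$ and $\{(k,2),(1,1)\}$; up to isomorphism these are all the circular strings over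 $\{a\}$. A product on $\mathbb K^d$ is a bilinear map $\odot:\mathbb K^d\times\mathbb K^d\to\mathbb K^d$ that is associative and symmetric. A rank $d$ ($d\geq 1$) Hypergraph Weighted Model (HWM) over $(\Sigma,\sharp)$ is a tuple $M=\langle \mathbb K^d,\{T^x\}_{x\in\Sigma},\odot,\alpha\rangle$ where $\odot$ is a product on $\mathbb K^d$, $\alpha\in\mathbb K^d$, and $T^x\in\bigotimes^{\sharp x}\mathbb K^d$ (viewed as an array $(T^x_{i_1\dots i_{\sharp x}})$) for each $x$. It computes the series $$r_M(G)=\sum_{\gamma:P_G\to[d]}\ \Big(\prod_{v\in V}T^{l(v)}_{\gamma(v,1)\dots\gamma(v,\sharp v)}\Big)\prod_{h\in E}\alpha^\top\Big(\bigodot_{p\in h}\mathbf e_{\gamma(p)}\Big)$$ (one factor for each port of $h$). A series $r:\mathcal H\to\mathbb K$ on a family $\mathcal H$ of hypergraphs over $(\Sigma,\sharp)$ is recognizable if there is a HWM $M$ (of some rank) with $r_M(G)=r(G)$ for all $G\in\mathcal H$. *)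

theory Defs
  imports
    Complex_Main
    "HOL-Library.Disjoint_Sets"
    "HOL-Library.FuncSet"
    "Jordan_Normal_Form.Matrix"
begin

section \<open>Hypergraphs over a ranked alphabet\<close>

definition positive_alphabet :: "'s set \<Rightarrow> ('s \<Rightarrow> nat) \<Rightarrow> bool" where
  "positive_alphabet S ar \<longleftrightarrow> finite S \<and> (\<forall>x\<in>S. 1 \<le> ar x)"

record ('v, 's) hypergraph =
  verts :: "'v set"
  hedges :: "('v \<times> nat) set set"
  lab :: "'v \<Rightarrow> 's"

definition ports :: "('s \<Rightarrow> nat) \<Rightarrow> ('v, 's) hypergraph \<Rightarrow> ('v \<times> nat) set" where
  "ports ar G = {(v, j). v \<in> verts G \<and> 1 \<le> j \<and> j \<le> ar (lab G v)}"

definition hypergraph :: "'s set \<Rightarrow> ('s \<Rightarrow> nat) \<Rightarrow> ('v, 's) hypergraph \<Rightarrow> bool" where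
  "hypergraph S ar G \<longleftrightarrow>
     positive_alphabet S ar \<and> finite (verts G) \<and> verts G \<noteq> {} \<and>
     lab G ` verts G \<subseteq> S \<and> partition_on (ports ar G) (hedges G)"

definition hconnected :: "('v, 's) hypergraph \<Rightarrow> bool" where
  "hconnected G \<longleftrightarrow>
     (\<forall>V1 V2. V1 \<union> V2 = verts G \<and> V1 \<inter> V2 = {} \<and> V1 \<noteq> {} \<and> V2 \<noteq> {} \<longrightarrow>
        (\<exists>h\<in>hedges G. \<exists>v1\<in>V1. \<exists>v2\<in>V2. \<exists>i j. (v1, i) \<in> h \<and> (v2, j) \<in> h))"

definition hisomorphic :: "('v, 's) hypergraph \<Rightarrow> ('w, 's) hypergraph \<Rightarrow> bool" where
  "hisomorphic G H \<longleftrightarrow>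
     (\<exists>f. bij_betw f (verts G) (verts H) \<and>
        (\<forall>v\<in>verts G. lab H (f v) = lab G v) \<and>
        hedges H = (\<lambda>h. (\<lambda>(v, j). (f v, j)) ` h) ` hedges G)"

text \<open>A series takes the same value on isomorphic hypergraphs.\<close>

definition series_on :: "('v, 's) hypergraph set \<Rightarrow> (('v, 's) hypergraph \<Rightarrow> 'k) \<Rightarrow> bool" where
  "series_on \<H> r \<longleftrightarrow> (\<forall>G\<in>\<H>. \<forall>H\<in>\<H>. hisomorphic G H \<longrightarrow> r G = r H)"

section \<open>Circular strings\<close>

definition circular_string :: "'s set \<Rightarrow> ('s \<Rightarrow> nat) \<Rightarrow> ('v, 's) hypergraph \<Rightarrow> bool" where
  "circular_string S ar G \<longleftrightarrow>
     (\<forall>x\<in>S. ar x = 2) \<and> hypergraph S ar G \<and> hconnected G \<and>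
     (\<forall>h\<in>hedges G. \<exists>v\<in>verts G. \<exists>w\<in>verts G. h = {(v, 2), (w, 1)})"

definition circular_strings :: "'s set \<Rightarrow> ('s \<Rightarrow> nat) \<Rightarrow> (nat, 's) hypergraph set" where
  "circular_strings S ar = {G. circular_string S ar G}"

definition circ_power :: "'s \<Rightarrow> nat \<Rightarrow> (nat, 's) hypergraph" where
  "circ_power a k =
     \<lparr>verts = {1..k},
      hedges = {{(i, 2), (i + 1, 1)} | i. 1 \<le> i \<and> i < k} \<union> {{(k, 2), (1, 1)}},
      lab = (\<lambda>_. a)\<rparr>"

section \<open>Hypergraph weighted models\<close>

definition product_on :: "nat \<Rightarrow> ('k::comm_ring_1 vec \<Rightarrow> 'k vec \<Rightarrow> 'k vec) \<Rightarrow> bool" where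
  "product_on d f \<longleftrightarrow>
     (\<forall>x\<in>carrier_vec d. \<forall>y\<in>carrier_vec d. f x y \<in> carrier_vec d) \<and>
     (\<forall>x\<in>carrier_vec d. \<forall>y\<in>carrier_vec d. \<forall>z\<in>carrier_vec d.
        f (x + y) z = f x z + f y z \<and> f z (x + y) = f z x + f z y) \<and>
     (\<forall>c. \<forall>x\<in>carrier_vec d. \<forall>y\<in>carrier_vec d.
        f (c \<cdot>\<^sub>v x) y = c \<cdot>\<^sub>v f x y \<and> f x (c \<cdot>\<^sub>v y) = c \<cdot>\<^sub>v f x y) \<and>
     (\<forall>x\<in>carrier_vec d. \<forall>y\<in>carrier_vec d. \<forall>z\<in>carrier_vec d. f (f x y) z = f x (f y z)) \<and>
     (\<forall>x\<in>carrier_vec d. \<forall>y\<in>carrier_vec d. f x y = f y x)"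

text \<open>
  Coordinates are numbered \<open>0, \<dots>, d - 1\<close>, as in \<open>unit_vec\<close>. A tensor of order \<open>n\<close> is an array
  whose entries are indexed by lists of length \<open>n\<close> over \<open>{..<d}\<close>; its values on other
  lists are never used.
\<close>

record ('s, 'k) hwm =
  hrank :: nat
  htensor :: "'s \<Rightarrow> nat list \<Rightarrow> 'k"
  hprod :: "'k vec \<Rightarrow> 'k vec \<Rightarrow> 'k vec"
  halpha :: "'k vec"

definition is_hwm :: "'s set \<Rightarrow> ('s \<Rightarrow> nat) \<Rightarrow> ('s, 'k::comm_ring_1) hwm \<Rightarrow> bool" where
  "is_hwm S ar M \<longleftrightarrow>
     finite S \<and> 1 \<le> hrank M \<and>
     product_on (hrank M) (hprod M) \<and> halpha M \<in> carrier_vec (hrank M)"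

text \<open>
  The product over a hyperedge has at least one factor, and the product need not have a unit.
  It is evaluated along an arbitrary enumeration of the hyperedge; \<open>edge_prod_eq\<close> below shows
  that the enumeration is irrelevant.
\<close>

fun fold_prod :: "('b \<Rightarrow> 'b \<Rightarrow> 'b) \<Rightarrow> 'b list \<Rightarrow> 'b" where
  "fold_prod f [] = undefined"
| "fold_prod f [x] = x"
| "fold_prod f (x # y # ys) = f x (fold_prod f (y # ys))"

definition edge_prod :: "('b \<Rightarrow> 'b \<Rightarrow> 'b) \<Rightarrow> ('p \<Rightarrow> 'b) \<Rightarrow> 'p set \<Rightarrow> 'b" where
  "edge_prod f e h = fold_prod f (map e (SOME ps. distinct ps \<and> set ps = h))"

definition hwm_series ::
  "('s \<Rightarrow> nat) \<Rightarrow> ('s, 'k::comm_ring_1) hwm \<Rightarrow> ('v, 's) hypergraph \<Rightarrow> 'k" where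
  "hwm_series ar M G =
     (\<Sum>\<gamma> \<in> ports ar G \<rightarrow>\<^sub>E {..<hrank M}.
        (\<Prod>v\<in>verts G. htensor M (lab G v) (map (\<lambda>j. \<gamma> (v, j)) [1..<Suc (ar (lab G v))])) *
        (\<Prod>h\<in>hedges G. halpha M \<bullet> edge_prod (hprod M) (\<lambda>p. unit_vec (hrank M) (\<gamma> p)) h))"

definition recognizable ::
  "'s set \<Rightarrow> ('s \<Rightarrow> nat) \<Rightarrow> ('v, 's) hypergraph set \<Rightarrow> (('v, 's) hypergraph \<Rightarrow> 'k::comm_ring_1) \<Rightarrow> bool" where
  "recognizable S ar \<H> r \<longleftrightarrow> (\<exists>M. is_hwm S ar M \<and> (\<forall>G\<in>\<H>. hwm_series ar M G = r G))"

section \<open>Well-definedness\<close>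

lemma fold_prod_closed:
  assumes "\<And>x y. x \<in> C \<Longrightarrow> y \<in> C \<Longrightarrow> f x y \<in> C" "set xs \<subseteq> C" "xs \<noteq> []"
  shows "fold_prod f xs \<in> C"
  using assms by (induction f xs rule: fold_prod.induct) auto

lemma fold_prod_Cons: "xs \<noteq> [] \<Longrightarrow> fold_prod f (x # xs) = f x (fold_prod f xs)"
  by (cases xs) auto

lemma fold_prod_move:
  assumes cl: "\<And>x y. x \<in> C \<Longrightarrow> y \<in> C \<Longrightarrow> f x y \<in> C"
    and as: "\<And>x y z. x \<in> C \<Longrightarrow> y \<in> C \<Longrightarrow> z \<in> C \<Longrightarrow> f (f x y) z = f x (f y z)"
    and co: "\<And>x y. x \<in> C \<Longrightarrow> y \<in> C \<Longrightarrow> f x y = f y x"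
    and "x \<in> C" "set xs \<subseteq> C" "set ys \<subseteq> C"
  shows "fold_prod f (xs @ x # ys) = fold_prod f (x # xs @ ys)"
  using assms(5)
proof (induction xs)
  case (Cons z zs)
  have "fold_prod f ((z # zs) @ x # ys) = f z (fold_prod f (x # zs @ ys))"
    using Cons by (simp add: fold_prod_Cons)
  also have "\<dots> = fold_prod f (x # (z # zs) @ ys)"
  proof (cases "zs @ ys = []")
    case True
    then show ?thesis using Cons.prems \<open>x \<in> C\<close> co by auto
  next
    case False
    define w where "w = fold_prod f (zs @ ys)"
    have "w \<in> C"
      unfolding w_def using False Cons.prems assms(6) by (intro fold_prod_closed cl) auto
    moreover have "z \<in> C" using Cons.prems by auto
    ultimately have "f z (f x w) = f x (f z w)"
      by (metis as co \<open>x \<in> C\<close>)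
    then show ?thesis using False by (simp add: fold_prod_Cons w_def)
  qed
  finally show ?case .
qed auto

lemma fold_prod_mset_eq:
  assumes cl: "\<And>x y. x \<in> C \<Longrightarrow> y \<in> C \<Longrightarrow> f x y \<in> C"
    and as: "\<And>x y z. x \<in> C \<Longrightarrow> y \<in> C \<Longrightarrow> z \<in> C \<Longrightarrow> f (f x y) z = f x (f y z)"
    and co: "\<And>x y. x \<in> C \<Longrightarrow> y \<in> C \<Longrightarrow> f x y = f y x"
    and "mset xs = mset ys" "set xs \<subseteq> C"
  shows "fold_prod f xs = fold_prod f ys"
  using assms(4,5)
proof (induction xs arbitrary: ys)
  case (Cons x xs)
  then have "x \<in> set ys" by (metis list.set_intros(1) mset_eq_setD)
  then obtain us vs where ys: "ys = us @ x # vs" by (meson split_list)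
  have sub: "set ys \<subseteq> C" using Cons.prems by (metis mset_eq_setD)
  have m: "mset xs = mset (us @ vs)" using Cons.prems(1) ys by simp
  have IH: "fold_prod f xs = fold_prod f (us @ vs)" using Cons.IH[OF m] Cons.prems(2) by auto
  have "fold_prod f ys = fold_prod f (x # us @ vs)"
    unfolding ys using sub ys by (intro fold_prod_move[where C = C] cl as co) auto
  also have "\<dots> = fold_prod f (x # xs)"
  proof (cases "xs = []")
    case True
    then show ?thesis using m by simp
  next
    case False
    then have "us @ vs \<noteq> []" using m by fastforce
    then show ?thesis using False IH by (simp add: fold_prod_Cons del: append_is_Nil_conv)
  qed
  finally show ?case by simp
qed auto

lemma edge_prod_eq:
  assumes "product_on d f" "distinct ps" "set ps = h" "e ` h \<subseteq> carrier_vec d"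
  shows "edge_prod f e h = fold_prod f (map e ps)"
proof -
  define qs where "qs = (SOME ps. distinct ps \<and> set ps = h)"
  have qs: "distinct qs \<and> set qs = h"
    unfolding qs_def by (rule someI[of _ ps]) (use assms in auto)
  then have "mset (map e qs) = mset (map e ps)"
    using assms(2,3) by (metis mset_map set_eq_iff_mset_eq_distinct)
  then show ?thesis
    unfolding edge_prod_def qs_def[symmetric]
    using assms(1,4) qs
    by (intro fold_prod_mset_eq[where C = "carrier_vec d"]) (auto simp: product_on_def)
qed

lemma circular_string_circ_power:
  assumes "k \<ge> 1"
  shows "circular_string {a} (\<lambda>_. 2) (circ_power a k)"
proof -
  let ?G = "circ_power a k"
  let ?nx = "\<lambda>i. if i < k then i + 1 else 1"
  have E: "hedges ?G = (\<lambda>i. {(i, 2), (?nx i, 1)}) ` {1..k}" (is "_ = ?e ` _")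
  proof -
    have "{1..k} = {i. 1 \<le> i \<and> i < k} \<union> {k}" using assms by auto
    then show ?thesis unfolding circ_power_def by (auto simp: image_def)
  qed
  have P: "ports (\<lambda>_. 2) ?G = {1..k} \<times> {1, 2}"
    by (auto simp: ports_def circ_power_def)
  have "partition_on (ports (\<lambda>_. 2) ?G) (hedges ?G)"
  proof (rule partition_onI)
    show "\<Union> (hedges ?G) = ports (\<lambda>_. 2) ?G"
    proof
      show "\<Union> (hedges ?G) \<subseteq> ports (\<lambda>_. 2) ?G"
        unfolding E P using assms by auto
      show "ports (\<lambda>_. 2) ?G \<subseteq> \<Union> (hedges ?G)"
      proof
        fix p assume "p \<in> ports (\<lambda>_. 2) ?G"
        then obtain v j where p: "p = (v, j)" "v \<in> {1..k}" "j = 1 \<or> j = 2" unfolding P by auto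
        consider "j = 2" | "j = 1" "v = 1" | "j = 1" "v > 1" using p by fastforce
        then show "p \<in> \<Union> (hedges ?G)"
        proof cases
          case 1
          then have "p \<in> ?e v" using p by simp
          then show ?thesis unfolding E using p by blast
        next
          case 2
          then have "p \<in> ?e k" using p by simp
          moreover have "k \<in> {1..k}" using assms by simp
          ultimately show ?thesis unfolding E by blast
        next
          case 3
          then have "p \<in> ?e (v - 1)" "v - 1 \<in> {1..k}" using p by auto
          then show ?thesis unfolding E by blast
        qed
      qed
    qed
    show "disjnt p q" if pq: "p \<in> hedges ?G" "q \<in> hedges ?G" "p \<noteq> q" for p q
    proof -
      obtain i j where ij: "p = ?e i" "q = ?e j" "i \<in> {1..k}" "j \<in> {1..k}"
        using pq(1,2) unfolding E by blast
      then have "i \<noteq> j" using pq(3) by blast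
      moreover from this have "?nx i \<noteq> ?nx j" using ij(3,4) by (auto split: if_splits)
      ultimately show ?thesis unfolding ij(1,2) by (auto simp: disjnt_def)
    qed
    show "{} \<notin> hedges ?G"
      unfolding E by auto
  qed
  moreover have "finite (verts ?G)" "verts ?G \<noteq> {}" "lab ?G ` verts ?G \<subseteq> {a}"
    using assms by (auto simp: circ_power_def)
  ultimately have "hypergraph {a} (\<lambda>_. 2) ?G"
    by (simp add: hypergraph_def positive_alphabet_def)
  moreover have "hconnected ?G"
    unfolding hconnected_def
  proof (intro allI impI)
    fix V1 V2
    assume V: "V1 \<union> V2 = verts ?G \<and> V1 \<inter> V2 = {} \<and> V1 \<noteq> {} \<and> V2 \<noteq> {}"
    have vs: "verts ?G = {1..k}" by (simp add: circ_power_def)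
    have "\<exists>i. 1 \<le> i \<and> i < k \<and> (i \<in> V1) \<noteq> (i + 1 \<in> V1)"
    proof (rule ccontr)
      assume "\<not> ?thesis"
      then have st: "(i + 1 \<in> V1) = (i \<in> V1)" if "1 \<le> i" "i < k" for i using that by blast
      have "(i \<in> V1) = (1 \<in> V1)" if "1 \<le> i" "i \<le> k" for i
        using that
      proof (induction i rule: dec_induct)
        case (step n)
        then show ?case using st[of n] by simp
      qed simp
      then show False using V vs by (metis Un_iff atLeastAtMost_iff disjoint_iff ex_in_conv)
    qed
    then obtain i where i: "1 \<le> i" "i < k" "(i \<in> V1) \<noteq> (i + 1 \<in> V1)" by blast
    have e: "{(i, 2), (i + 1, 1)} \<in> hedges ?G" using i by (auto simp: circ_power_def)
    have m: "i \<in> V1 \<union> V2" "i + 1 \<in> V1 \<union> V2" using i V vs by auto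
    show "\<exists>h\<in>hedges ?G. \<exists>v1\<in>V1. \<exists>v2\<in>V2. \<exists>i j. (v1, i) \<in> h \<and> (v2, j) \<in> h"
    proof (cases "i \<in> V1")
      case True
      then have "i + 1 \<in> V2" using i m by blast
      with True show ?thesis
        by (intro bexI[OF _ e] bexI[of _ "i"] bexI[of _ "i + 1"] exI[of _ 2] exI[of _ 1]) auto
    next
      case False
      then have "i + 1 \<in> V1" "i \<in> V2" using i m by blast+
      then show ?thesis
        by (intro bexI[OF _ e] bexI[of _ "i + 1"] bexI[of _ "i"] exI[of _ 1] exI[of _ 2]) auto
    qed
  qed
  moreover have "\<forall>h\<in>hedges ?G. \<exists>v\<in>verts ?G. \<exists>w\<in>verts ?G. h = {(v, 2), (w, 1)}"
  proof
    fix h assume "h \<in> hedges ?G"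
    then obtain i where i: "i \<in> {1..k}" "h = ?e i" unfolding E by blast
    have "verts ?G = {1..k}" by (simp add: circ_power_def)
    moreover from i(1) have "?nx i \<in> {1..k}" by auto
    ultimately show "\<exists>v\<in>verts ?G. \<exists>w\<in>verts ?G. h = {(v, 2), (w, 1)}"
      using i by blast
  qed
  ultimately show ?thesis by (simp add: circular_string_def)
qed

text \<open>The series with value \<open>1\<close> on the one-vertex circular string and \<open>0\<close> on the others exists.\<close>

lemma unit_circ_series_exists:
  "\<exists>r :: (nat, 's) hypergraph \<Rightarrow> 'k::zero_neq_one.
     series_on (circular_strings {a} (\<lambda>_. 2)) r \<and>
     r (circ_power a 1) = 1 \<and> (\<forall>k>1. r (circ_power a k) = 0)"
  by (rule exI[of _ "\<lambda>G. if card (verts G) = 1 then 1 else 0"])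
    (auto simp: series_on_def circ_power_def hisomorphic_def dest!: bij_betw_same_card)

end

theory Submission
  imports Defs "Jordan_Normal_Form.Jordan_Normal_Form_Existence"
begin

text \<open>
  Contracting the ports edge by edge, the value of a model on the circular string of length \<open>k\<close> is
  the trace of \<open>A ^ k\<close>, where \<open>A\<close> is the matrix of \<open>T\<close> times the Gram matrix of the bilinear form
  \<open>(x, y) \<mapsto> \<alpha>\<^sup>T (x \<odot> y)\<close>. Over the complex numbers the traces are the power sums of the
  eigenvalues; if these vanish for all exponents \<open>k > 1\<close>, then every eigenvalue is zero, hence so
  is the trace of \<open>A\<close> itself.
\<close>

section \<open>Vanishing power sums\<close>

text \<open>By linearity the values \<open>f i\<close>, weighted by \<open>f i ^ 2\<close>,
  annihilate every polynomial. A polynomial vanishing at all values other than \<open>f i0\<close>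
  isolates the multiplicity of \<open>f i0\<close>, which is nonzero in characteristic 0.\<close>

lemma power_sums_zero_imp_zero:
  fixes f :: "'b \<Rightarrow> 'a::field_char_0"
  assumes fin: "finite I" and ps: "\<And>k. k > 1 \<Longrightarrow> (\<Sum>i\<in>I. f i ^ k) = 0" and "i0 \<in> I"
  shows "f i0 = 0"
proof -
  \<comment> \<open>The exponents \<open>j + 2\<close> are exactly those above 1; this is where the
    weight \<open>f i ^ 2\<close> comes from.\<close>
  have ps_shift: "(\<Sum>i\<in>I. f i ^ (j + 2)) = 0" for j by (rule ps) simp
  have poly_sum: "(\<Sum>i\<in>I. f i ^ 2 * poly p (f i)) = 0" for p
  proof -
    have "(\<Sum>i\<in>I. f i ^ 2 * poly p (f i)) = (\<Sum>i\<in>I. \<Sum>j\<le>degree p. coeff p j * f i ^ (j + 2))"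
      by (simp add: poly_altdef sum_distrib_left power_add power2_eq_square mult_ac)
    also have "\<dots> = (\<Sum>j\<le>degree p. coeff p j * (\<Sum>i\<in>I. f i ^ (j + 2)))"
      by (subst sum.swap) (simp add: sum_distrib_left)
    also have "\<dots> = 0"
      by (simp only: ps_shift mult_zero_right sum.neutral_const)
    finally show ?thesis .
  qed
  define p where "p = (\<Prod>\<nu>\<in>f ` I - {f i0}. [:- \<nu>, 1:])"
  have p0: "poly p (f i) = 0" if "i \<in> I" "f i \<noteq> f i0" for i
    using that fin by (auto simp: p_def poly_prod)
  have p1: "poly p (f i0) \<noteq> 0"
    using fin by (auto simp: p_def poly_prod)
  define J where "J = {i \<in> I. f i = f i0}"
  have "0 = (\<Sum>i\<in>I. f i ^ 2 * poly p (f i))" by (simp add: poly_sum)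
  also have "\<dots> = (\<Sum>i\<in>J. f i ^ 2 * poly p (f i))"
    using p0 fin by (intro sum.mono_neutral_right) (auto simp: J_def)
  also have "\<dots> = of_nat (card J) * (f i0 ^ 2 * poly p (f i0))"
    by (simp add: J_def)
  finally have "of_nat (card J) * (f i0 ^ 2 * poly p (f i0)) = 0" by simp
  moreover have "card J \<noteq> 0" using fin \<open>i0 \<in> I\<close> by (auto simp: J_def)
  ultimately show ?thesis using p1 by simp
qed

section \<open>Traces of matrix powers\<close>

definition mat_trace :: "'a::comm_monoid_add mat \<Rightarrow> 'a" where
  "mat_trace A = (\<Sum>i<dim_row A. A $$ (i, i))"

lemma mat_trace_comm:
  fixes A :: "'a::comm_semiring_0 mat"
  assumes A: "A \<in> carrier_mat n m" and B: "B \<in> carrier_mat m n"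
  shows "mat_trace (A * B) = mat_trace (B * A)"
proof -
  have "mat_trace (A * B) = (\<Sum>i<n. \<Sum>j<m. A $$ (i, j) * B $$ (j, i))"
    using A B by (auto simp: mat_trace_def scalar_prod_def atLeast0LessThan)
  also have "\<dots> = (\<Sum>j<m. \<Sum>i<n. B $$ (j, i) * A $$ (i, j))"
    by (subst sum.swap) (simp add: mult.commute)
  also have "\<dots> = mat_trace (B * A)"
    using A B by (auto simp: mat_trace_def scalar_prod_def atLeast0LessThan)
  finally show ?thesis .
qed

lemma mat_trace_similar:
  fixes A B :: "'a::comm_ring_1 mat"
  assumes "similar_mat A B"
  shows "mat_trace A = mat_trace B"
proof -
  obtain n P Q where c: "{A, B, P, Q} \<subseteq> carrier_mat n n"
    and QP: "Q * P = 1\<^sub>m n" and A: "A = P * B * Q"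
    using similar_matD[OF assms] by blast
  have "mat_trace A = mat_trace (P * (B * Q))" using c A by (simp add: assoc_mult_mat[of _ n n _ n _ n])
  also have "\<dots> = mat_trace (B * Q * P)" using c by (intro mat_trace_comm[of _ n n]) auto
  also have "B * Q * P = B" using c QP by (auto simp: assoc_mult_mat[of _ n n _ n _ n])
  finally show ?thesis .
qed

lemma pow_mat_one:
  assumes "A \<in> carrier_mat n n"
  shows "A ^\<^sub>m 1 = A"
  using assms by simp

text \<open>Both claims go through one induction, since the diagonal of a product is the product of
  the diagonals only when both factors are triangular.\<close>

lemma upper_triangular_pow_diag:
  fixes B :: "'a::comm_ring_1 mat"
  assumes B: "B \<in> carrier_mat n n" and ut: "upper_triangular B"
  shows "upper_triangular (B ^\<^sub>m k) \<and> (\<forall>i<n. (B ^\<^sub>m k) $$ (i, i) = (B $$ (i, i)) ^ k)"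
proof (induction k)
  case 0
  then show ?case using B by auto
next
  case (Suc k)
  let ?C = "B ^\<^sub>m k"
  have C: "?C \<in> carrier_mat n n" using B by simp
  have low: "?C $$ (i, l) = 0" if "i < n" "l < i" for i l
    using Suc C that by auto
  have lowB: "B $$ (i, l) = 0" if "i < n" "l < i" for i l
    using ut B that by auto
  have ent: "(?C * B) $$ (i, j) = (\<Sum>l<n. ?C $$ (i, l) * B $$ (l, j))" if "i < n" "j < n" for i j
    using that B C by (simp add: scalar_prod_def atLeast0LessThan)
  have "(?C * B) $$ (i, j) = 0" if "i < n" "j < i" for i j
  proof -
    \<comment> \<open>For \<open>l < i\<close> the first factor lies below the diagonal; otherwise
      \<open>j < i\<close> and \<open>i \<le> l\<close> put the second one there.\<close>
    have "?C $$ (i, l) * B $$ (l, j) = 0" if "l < n" for l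
      using low[of i l] lowB[of l j] \<open>i < n\<close> \<open>j < i\<close> that by (cases "l < i") auto
    then show ?thesis using that by (simp add: ent)
  qed
  moreover have "(?C * B) $$ (i, i) = (B $$ (i, i)) ^ Suc k" if "i < n" for i
  proof -
    have "(\<Sum>l<n. ?C $$ (i, l) * B $$ (l, i)) = (\<Sum>l\<in>{i}. ?C $$ (i, l) * B $$ (l, i))"
      using that low[of i] lowB[of _ i]
      by (intro sum.mono_neutral_right) (auto, metis linorder_neqE_nat mult_zero_left mult_zero_right)
    then show ?thesis using that Suc by (simp add: ent mult.commute)
  qed
  ultimately show ?case using B C by (auto intro!: upper_triangularI)
qed

text \<open>Over the complex numbers the characteristic polynomial splits, so a Schur form exists.
  Its powers stay similar to those of \<open>A\<close>, and the traces become power sums of its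
  diagonal.\<close>

lemma complex_mat_trace_zero:
  fixes A :: "complex mat"
  assumes A: "A \<in> carrier_mat n n" and tr: "\<And>k. k > 1 \<Longrightarrow> mat_trace (A ^\<^sub>m k) = 0"
  shows "mat_trace A = 0"
proof -
  obtain es where "char_poly A = (\<Prod>a\<leftarrow>es. [:- a, 1:])"
    using char_poly_factorized[OF A] by auto
  from schur_decomposition_exists[OF A this] obtain B
    where B: "B \<in> carrier_mat n n" "upper_triangular B" and sim: "similar_mat A B" by auto
  have simk: "similar_mat (A ^\<^sub>m k) (B ^\<^sub>m k)" for k
    using sim similar_mat_wit_pow unfolding similar_mat_def by blast
  have trB: "mat_trace (A ^\<^sub>m k) = (\<Sum>i<n. (B $$ (i, i)) ^ k)" for k
    using mat_trace_similar[OF simk, of k] upper_triangular_pow_diag[OF B, of k] B(1)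
    by (simp add: mat_trace_def[of "B ^\<^sub>m k"])
  have "B $$ (i, i) = 0" if "i < n" for i
    by (rule power_sums_zero_imp_zero[of "{..<n}"]) (use that in \<open>simp_all flip: trB add: tr\<close>)
  then show ?thesis using trB[of 1] unfolding pow_mat_one[OF A] by simp
qed

text \<open>A real matrix may have non-real eigenvalues, so it is complexified; the embedding is
  injective and commutes with powers and traces.\<close>

lemma real_mat_trace_zero:
  fixes A :: "real mat"
  assumes A: "A \<in> carrier_mat n n" and tr: "\<And>k. k > 1 \<Longrightarrow> mat_trace (A ^\<^sub>m k) = 0"
  shows "mat_trace A = 0"
proof -
  let ?C = "map_mat complex_of_real A"
  have C: "?C \<in> carrier_mat n n" using A by simp
  have tr_hom: "mat_trace (map_mat complex_of_real D) = complex_of_real (mat_trace D)"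
    if "D \<in> carrier_mat n n" for D
    using that by (simp add: mat_trace_def)
  have "mat_trace (?C ^\<^sub>m k) = complex_of_real (mat_trace (A ^\<^sub>m k))" for k
    using tr_hom[OF pow_carrier_mat[OF A, of k]] by (simp only: of_real_hom.mat_hom_pow[OF A])
  then have "mat_trace ?C = 0" using complex_mat_trace_zero[OF C] tr by simp
  then show ?thesis using tr_hom[OF A] by simp
qed

section \<open>Matrix powers as sums over walks\<close>

text \<open>An entry of \<open>A ^\<^sub>m n\<close> sums the weights of the walks with
  \<open>n\<close> steps, that is, \<open>Suc n\<close> positions. The arbitrary endpoint weight
  \<open>h\<close> lets the induction absorb the last step, and later closes the walk.\<close>

lemma sum_walks_eq_pow_mat:
  fixes A :: "'a::comm_ring_1 mat"
  assumes A: "A \<in> carrier_mat d d"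
  shows "(\<Sum>f\<in>{1..Suc n} \<rightarrow>\<^sub>E {..<d}. (\<Prod>v\<in>{1..<Suc n}. A $$ (f v, f (Suc v))) * h (f 1) (f (Suc n)))
    = (\<Sum>i<d. \<Sum>j<d. (A ^\<^sub>m n) $$ (i, j) * h i j)"
proof (induction n arbitrary: h)
  case 0
  have "(\<Sum>f\<in>{1..Suc 0} \<rightarrow>\<^sub>E {..<d}. h (f 1) (f 1)) = (\<Sum>i<d. h i i)"
    by (rule sum.reindex_bij_witness[where i = "\<lambda>x. \<lambda>v\<in>{1..Suc 0}. x" and j = "\<lambda>f. f 1"])
      (auto simp: PiE_def extensional_def fun_eq_iff)
  moreover have "(\<Sum>j<d. (1\<^sub>m d) $$ (i, j) * h i j) = h i i" if "i < d" for i
  proof -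
    have "(\<Sum>j<d. (1\<^sub>m d) $$ (i, j) * h i j) = (\<Sum>j<d. if j = i then h i j else 0)"
      using that by (intro sum.cong) auto
    then show ?thesis using that by simp
  qed
  ultimately show ?case using A by simp
next
  case (Suc n)
  let ?P = "\<lambda>f. \<Prod>v\<in>{1..<Suc n}. A $$ (f v, f (Suc v))"
  have ins: "{1..Suc (Suc n)} = insert (Suc (Suc n)) {1..Suc n}" by auto
  have "(\<Sum>f\<in>{1..Suc (Suc n)} \<rightarrow>\<^sub>E {..<d}.
           (\<Prod>v\<in>{1..<Suc (Suc n)}. A $$ (f v, f (Suc v))) * h (f 1) (f (Suc (Suc n))))
    = (\<Sum>(x, f)\<in>{..<d} \<times> ({1..Suc n} \<rightarrow>\<^sub>E {..<d}). ?P f * (A $$ (f (Suc n), x) * h (f 1) x))"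
    unfolding ins PiE_insert_eq
    by (subst sum.reindex[OF inj_combinator]) (auto intro!: sum.cong prod.cong simp: mult.assoc)
  also have "\<dots> = (\<Sum>f\<in>{1..Suc n} \<rightarrow>\<^sub>E {..<d}. ?P f * (\<Sum>x<d. A $$ (f (Suc n), x) * h (f 1) x))"
    by (simp add: sum.cartesian_product[symmetric] sum_distrib_left) (rule sum.swap)
  \<comment> \<open>The induction hypothesis is taken with the last step and \<open>h\<close>
    together as the new endpoint weight.\<close>
  also have "\<dots> = (\<Sum>i<d. \<Sum>j<d. (A ^\<^sub>m n) $$ (i, j) * (\<Sum>x<d. A $$ (j, x) * h i x))"
    by (rule Suc.IH)
  also have "\<dots> = (\<Sum>i<d. \<Sum>x<d. (A ^\<^sub>m Suc n) $$ (i, x) * h i x)"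
  proof (rule sum.cong[OF refl])
    fix i assume i: "i \<in> {..<d}"
    have "(\<Sum>j<d. (A ^\<^sub>m n) $$ (i, j) * (\<Sum>x<d. A $$ (j, x) * h i x))
      = (\<Sum>x<d. (\<Sum>j<d. (A ^\<^sub>m n) $$ (i, j) * A $$ (j, x)) * h i x)"
      by (simp add: sum_distrib_left sum_distrib_right mult.assoc) (rule sum.swap)
    also have "\<dots> = (\<Sum>x<d. (A ^\<^sub>m Suc n) $$ (i, x) * h i x)"
      using i A by (intro sum.cong) (auto simp: scalar_prod_def atLeast0LessThan)
    finally show "(\<Sum>j<d. (A ^\<^sub>m n) $$ (i, j) * (\<Sum>x<d. A $$ (j, x) * h i x)) = \<dots>" .
  qed
  finally show ?case .
qed

text \<open>Indexes all hyperedges of \<open>circ_power a k\<close> uniformly by vertices, including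
  the closing one and the loop at \<open>k = 1\<close>.\<close>

definition cyc_next :: "nat \<Rightarrow> nat \<Rightarrow> nat" where
  "cyc_next k i = (if i < k then i + 1 else 1)"

text \<open>Cutting a closed walk at its step from \<open>k\<close> back to \<open>1\<close> leaves
  an open walk with \<open>k - 1\<close> steps; the removed entry of \<open>A\<close> serves as the
  endpoint weight.\<close>

lemma mat_trace_pow_eq_sum_closed_walks:
  fixes A :: "'a::comm_ring_1 mat"
  assumes A: "A \<in> carrier_mat d d" and "k \<ge> 1"
  shows "(\<Sum>f\<in>{1..k} \<rightarrow>\<^sub>E {..<d}. \<Prod>v\<in>{1..k}. A $$ (f v, f (cyc_next k v))) = mat_trace (A ^\<^sub>m k)"
proof -
  obtain n where k: "k = Suc n" using \<open>k \<ge> 1\<close> by (cases k) auto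
  have "(\<Prod>v\<in>{1..k}. A $$ (f v, f (cyc_next k v)))
    = (\<Prod>v\<in>{1..<Suc n}. A $$ (f v, f (Suc v))) * A $$ (f (Suc n), f 1)" for f
  proof -
    have "{1..k} = insert k {1..<k}" using \<open>k \<ge> 1\<close> by auto
    then show ?thesis by (simp add: k cyc_next_def mult.commute)
  qed
  then have "(\<Sum>f\<in>{1..k} \<rightarrow>\<^sub>E {..<d}. \<Prod>v\<in>{1..k}. A $$ (f v, f (cyc_next k v)))
    = (\<Sum>i<d. \<Sum>j<d. (A ^\<^sub>m n) $$ (i, j) * A $$ (j, i))"
    using sum_walks_eq_pow_mat[OF A, of n "\<lambda>i j. A $$ (j, i)"] by (simp add: k)
  also have "\<dots> = mat_trace (A ^\<^sub>m k)"
    using A by (auto simp: k mat_trace_def scalar_prod_def atLeast0LessThan intro!: sum.cong)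
  finally show ?thesis .
qed

section \<open>From circular strings to traces\<close>

text \<open>Each hyperedge contains exactly one port numbered 2, which determines \<open>v\<close>;
  hence distinct vertices give distinct hyperedges and no factor is lost.\<close>

lemma prod_hedges_circ_power:
  assumes "k \<ge> 1"
  shows "(\<Prod>h\<in>hedges (circ_power a k). g h) = (\<Prod>v\<in>{1..k}. g {(v, 2), (cyc_next k v, 1)})"
proof -
  have "{1..k} = {i. 1 \<le> i \<and> i < k} \<union> {k}" using assms by auto
  then have "hedges (circ_power a k) = (\<lambda>v. {(v, 2), (cyc_next k v, 1)}) ` {1..k}"
    by (auto simp: circ_power_def cyc_next_def image_def)
  moreover have "inj_on (\<lambda>v. {(v, 2::nat), (cyc_next k v, 1)}) {1..k}"
    by (auto simp: inj_on_def doubleton_eq_iff)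
  ultimately show ?thesis by (simp add: prod.reindex)
qed

text \<open>Rows belong to port 1 of a vertex, columns to port 1 of the next one; the inner index,
  at port 2, is summed out.\<close>

definition transition_mat :: "'s \<Rightarrow> ('s, 'k::comm_ring_1) hwm \<Rightarrow> 'k mat" where
  "transition_mat a M =
     mat (hrank M) (hrank M) (\<lambda>(i, j). htensor M a [i, j]) *
     mat (hrank M) (hrank M)
       (\<lambda>(i, j). halpha M \<bullet> hprod M (unit_vec (hrank M) i) (unit_vec (hrank M) j))"

text \<open>A port labelling is a pair of vertex labellings, \<open>f\<close> at ports 1 and
  \<open>g\<close> at ports 2. Each \<open>g v\<close> occurs in a single tensor factor and a single
  hyperedge factor, so summing over \<open>g\<close> leaves closed walks \<open>f\<close> weighted
  by the transition matrix.\<close>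

lemma hwm_series_circ_power:
  fixes M :: "('s, 'k::comm_ring_1) hwm"
  assumes M: "is_hwm S ar M" and k: "k \<ge> 1"
  shows "hwm_series (\<lambda>_. 2) M (circ_power a k) = mat_trace (transition_mat a M ^\<^sub>m k)"
proof -
  define d where "d = hrank M"
  define e where "e = (unit_vec d :: nat \<Rightarrow> 'k vec)"
  define T where "T = (\<lambda>i j. htensor M a [i, j])"
  define B where "B = (\<lambda>i j. halpha M \<bullet> hprod M (e i) (e j))"
  let ?A = "transition_mat a M"
  let ?N = "cyc_next k"
  have pr: "product_on d (hprod M)" using M by (simp add: is_hwm_def d_def)
  have A: "?A \<in> carrier_mat d d"
    unfolding transition_mat_def d_def by (rule mult_carrier_mat) auto
  have A_ent: "?A $$ (i, l) = (\<Sum>j<d. T i j * B j l)" if "i < d" "l < d" for i l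
    using that
    by (simp add: transition_mat_def scalar_prod_def atLeast0LessThan T_def B_def e_def d_def)
  have ports: "ports (\<lambda>_. 2) (circ_power a k) = {1..k} \<times> {1, 2}"
    by (auto simp: ports_def circ_power_def)
  have upt2: "[1..<Suc 2] = [1, 2]" by (simp add: numeral_2_eq_2)
  have N: "?N v \<in> {1..k}" if "v \<in> {1..k}" for v using that by (auto simp: cyc_next_def)
  \<comment> \<open>The port numbers differ, so there are two factors even if \<open>v = w\<close>,
    as happens for \<open>k = 1\<close>.\<close>
  have edge: "edge_prod (hprod M) (\<lambda>p. e (\<gamma> p)) {(v, 2), (w, 1)} = hprod M (e (\<gamma> (v, 2))) (e (\<gamma> (w, 1)))"
    for \<gamma> :: "nat \<times> nat \<Rightarrow> nat" and v w
    by (subst edge_prod_eq[OF pr, where ps = "[(v, 2), (w, 1)]"]) (auto simp: e_def)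
  have "hwm_series (\<lambda>_. 2) M (circ_power a k)
    = (\<Sum>\<gamma>\<in>({1..k} \<times> {1, 2::nat}) \<rightarrow>\<^sub>E {..<d}.
        (\<Prod>v\<in>{1..k}. T (\<gamma> (v, 1)) (\<gamma> (v, 2))) * (\<Prod>v\<in>{1..k}. B (\<gamma> (v, 2)) (\<gamma> (?N v, 1))))"
    unfolding hwm_series_def ports prod_hedges_circ_power[OF k] d_def[symmetric] e_def[symmetric] edge
    by (simp only: upt2 list.map T_def B_def) (simp add: circ_power_def)
  also have "\<dots> = (\<Sum>(f, g)\<in>({1..k} \<rightarrow>\<^sub>E {..<d}) \<times> ({1..k} \<rightarrow>\<^sub>E {..<d}).
        (\<Prod>v\<in>{1..k}. T (f v) (g v)) * (\<Prod>v\<in>{1..k}. B (g v) (f (?N v))))"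
  proof (rule sum.reindex_bij_witness[where
        i = "\<lambda>(f, g). \<lambda>p\<in>{1..k} \<times> {1, 2}. if snd p = 1 then f (fst p) else g (fst p)" and
        j = "\<lambda>\<gamma>. (\<lambda>v\<in>{1..k}. \<gamma> (v, 1), \<lambda>v\<in>{1..k}. \<gamma> (v, 2))"], goal_cases)
    case (1 \<gamma>)
    then show ?case by (auto simp: PiE_def extensional_def fun_eq_iff)
  next
    case (2 \<gamma>)
    then show ?case by auto
  next
    case (3 fg)
    then show ?case by (auto simp: PiE_def extensional_def fun_eq_iff)
  next
    case (4 fg)
    then show ?case by (auto split: if_splits)
  next
    case (5 \<gamma>)
    \<comment> \<open>The restricted \<open>f\<close> is evaluated at \<open>?N v\<close>;
      \<open>N\<close> keeps that point inside its domain.\<close>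
    then show ?case using N by (auto intro!: arg_cong2[where f = "(*)"] prod.cong)
  qed
  also have "\<dots> = (\<Sum>f\<in>{1..k} \<rightarrow>\<^sub>E {..<d}. \<Sum>g\<in>{1..k} \<rightarrow>\<^sub>E {..<d}.
        \<Prod>v\<in>{1..k}. T (f v) (g v) * B (g v) (f (?N v)))"
    by (simp add: sum.cartesian_product[symmetric] prod.distrib)
  also have "\<dots> = (\<Sum>f\<in>{1..k} \<rightarrow>\<^sub>E {..<d}. \<Prod>v\<in>{1..k}. ?A $$ (f v, f (?N v)))"
  proof (rule sum.cong[OF refl])
    fix f assume f: "f \<in> {1..k} \<rightarrow>\<^sub>E {..<d}"
    have "(\<Sum>g\<in>{1..k} \<rightarrow>\<^sub>E {..<d}. \<Prod>v\<in>{1..k}. T (f v) (g v) * B (g v) (f (?N v)))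
      = (\<Prod>v\<in>{1..k}. \<Sum>j<d. T (f v) j * B j (f (?N v)))"
      \<comment> \<open>Distributivity read backwards: the values \<open>g v\<close> are chosen
        independently for each \<open>v\<close>.\<close>
      by (rule prod_sum_PiE[symmetric]) auto
    also have "\<dots> = (\<Prod>v\<in>{1..k}. ?A $$ (f v, f (?N v)))"
      using f N by (intro prod.cong refl A_ent[symmetric]) (auto dest: PiE_mem)
    finally show "(\<Sum>g\<in>{1..k} \<rightarrow>\<^sub>E {..<d}. \<Prod>v\<in>{1..k}. T (f v) (g v) * B (g v) (f (?N v))) = \<dots>" .
  qed
  also have "\<dots> = mat_trace (?A ^\<^sub>m k)"
    by (rule mat_trace_pow_eq_sum_closed_walks[OF A k])
  finally show ?thesis .
qed

section \<open>Non-recognizability\<close>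

text \<open>The reduction to traces works over any commutative ring; the field-dependent fact is
  isolated in \<open>rigid\<close>, so that one argument serves the real and the complex case. The
  trace of the transition matrix would be both 0 and 1.\<close>

lemma not_recognizable_if_trace_rigid:
  fixes r :: "(nat, 's) hypergraph \<Rightarrow> 'k::comm_ring_1"
  assumes r1: "r (circ_power a 1) = 1" and r0: "\<forall>k>1. r (circ_power a k) = 0"
    and rigid: "\<And>n (A :: 'k mat). A \<in> carrier_mat n n \<Longrightarrow>
      (\<And>k. k > 1 \<Longrightarrow> mat_trace (A ^\<^sub>m k) = 0) \<Longrightarrow> mat_trace A = 0"
  shows "\<not> recognizable {a} (\<lambda>_. 2) (circular_strings {a} (\<lambda>_. 2)) r"
proof
  assume "recognizable {a} (\<lambda>_. 2) (circular_strings {a} (\<lambda>_. 2)) r"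
  then obtain M where M: "is_hwm {a} (\<lambda>_. 2) M"
    and eq: "\<And>G. G \<in> circular_strings {a} (\<lambda>_. 2) \<Longrightarrow> hwm_series (\<lambda>_. 2) M G = r G"
    unfolding recognizable_def by blast
  let ?A = "transition_mat a M"
  have A: "?A \<in> carrier_mat (hrank M) (hrank M)"
    unfolding transition_mat_def by (rule mult_carrier_mat) auto
  have tr: "mat_trace (?A ^\<^sub>m k) = r (circ_power a k)" if "k \<ge> 1" for k
    using hwm_series_circ_power[OF M that, of a] eq[of "circ_power a k"]
      circular_string_circ_power[OF that, of a] by (simp add: circular_strings_def)
  have "mat_trace ?A = 0" by (rule rigid[OF A]) (simp add: tr r0)
  moreover have "mat_trace ?A = 1" using tr[of 1] r1 unfolding pow_mat_one[OF A] by simp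
  ultimately show False by simp
qed

theorem mainTheorem3:
  fixes a :: 's
  shows
    "(\<forall>r :: (nat, 's) hypergraph \<Rightarrow> real.
        series_on (circular_strings {a} (\<lambda>_. 2)) r \<and> r (circ_power a 1) = 1 \<and> (\<forall>k>1. r (circ_power a k) = 0)
        \<longrightarrow> \<not> recognizable {a} (\<lambda>_. 2) (circular_strings {a} (\<lambda>_. 2)) r) \<and>
     (\<forall>r :: (nat, 's) hypergraph \<Rightarrow> complex.
        series_on (circular_strings {a} (\<lambda>_. 2)) r \<and> r (circ_power a 1) = 1 \<and> (\<forall>k>1. r (circ_power a k) = 0)
        \<longrightarrow> \<not> recognizable {a} (\<lambda>_. 2) (circular_strings {a} (\<lambda>_. 2)) r)"
proof (intro conjI allI impI; elim conjE)
  fix r :: "(nat, 's) hypergraph \<Rightarrow> real"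
  assume "r (circ_power a 1) = 1" "\<forall>k>1. r (circ_power a k) = 0"
  then show "\<not> recognizable {a} (\<lambda>_. 2) (circular_strings {a} (\<lambda>_. 2)) r"
    by (rule not_recognizable_if_trace_rigid) (erule real_mat_trace_zero, blast)
next
  fix r :: "(nat, 's) hypergraph \<Rightarrow> complex"
  assume "r (circ_power a 1) = 1" "\<forall>k>1. r (circ_power a k) = 0"
  then show "\<not> recognizable {a} (\<lambda>_. 2) (circular_strings {a} (\<lambda>_. 2)) r"
    by (rule not_recognizable_if_trace_rigid) (erule complex_mat_trace_zero, blast)
qed

end
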